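(* Let $V:\mathbb{R}^d\to\mathbb{R}^d$ be a monotone, continuously differentiable, $L$-Lipschitz map with $V(0)=0$ (so that $z^\star=0$ solves the variational inequality $\langle z-z^\star,V(z)\rangle\ge0$ for all $z\in\mathbb{R}^d$). Let $0<\gamma\le\frac{1}{16L}$, let $z_1=z_0\in\mathbb{R}^d$, and let $$z_{n+1}=z_n-2\gamma V(z_n)+\gamma V(z_{n-1}),\qquad n\ge1.$$ Then for all $n\ge1$ $$\min_{i\in\{1,\dots,n\}}\|V(z_i)\|_2\le O\!\left(\sqrt{\frac{1}{\gamma^2}+L^2}\cdot\frac{\|z_0\|_2}{\sqrt n}\right),$$ and moreover $\lim_{n\to\infty}\|V(z_n)\|_2=0$.
   Context: $V$ is monotone if $\langle z-z',V(z)-V(z')\rangle\ge0$ for all $z,z'\in\mathbb{R}^d$. $O(\cdot)$ hides a universal multiplicative constant. *)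

theory Defs
  imports "HOL-Analysis.Analysis"
begin

text \<open>
  The universal constant must not depend on the dimension, so the dimension is a natural number
  rather than a type: $R^d$ is the carrier of the library's \<^const>\<open>Euclidean_space\<close> topology,
  i.e. the functions \<^typ>\<open>nat \<Rightarrow> real\<close> that vanish at all indices \<open>i \<ge> d\<close>.
\<close>

abbreviation Rn :: "nat \<Rightarrow> (nat \<Rightarrow> real) set" where
  "Rn d \<equiv> topspace (Euclidean_space d)"

definition norm2 :: "nat \<Rightarrow> (nat \<Rightarrow> real) \<Rightarrow> real" where
  "norm2 d x = L2_set x {..<d}"

definition inner_Rn :: "nat \<Rightarrow> (nat \<Rightarrow> real) \<Rightarrow> (nat \<Rightarrow> real) \<Rightarrow> real" where
  "inner_Rn d x y = (\<Sum>i<d. x i * y i)"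

definition monotone_field :: "nat \<Rightarrow> ((nat \<Rightarrow> real) \<Rightarrow> nat \<Rightarrow> real) \<Rightarrow> bool" where
  "monotone_field d V \<longleftrightarrow>
     (\<forall>x\<in>Rn d. \<forall>y\<in>Rn d. inner_Rn d (\<lambda>i. x i - y i) (\<lambda>i. V x i - V y i) \<ge> 0)"

definition lipschitz_map :: "nat \<Rightarrow> real \<Rightarrow> ((nat \<Rightarrow> real) \<Rightarrow> nat \<Rightarrow> real) \<Rightarrow> bool" where
  "lipschitz_map d L V \<longleftrightarrow>
     (\<forall>x\<in>Rn d. \<forall>y\<in>Rn d. norm2 d (\<lambda>i. V x i - V y i) \<le> L * norm2 d (\<lambda>i. x i - y i))"

text \<open>
  Continuous differentiability on $R^d$: every partial derivative of every component exists
  everywhere and is continuous; \<open>D i j\<close> is the \<open>j\<close>-th partial derivative of the \<open>i\<close>-th component.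
\<close>

definition C1_map :: "nat \<Rightarrow> ((nat \<Rightarrow> real) \<Rightarrow> nat \<Rightarrow> real) \<Rightarrow> bool" where
  "C1_map d V \<longleftrightarrow>
     (\<exists>D :: nat \<Rightarrow> nat \<Rightarrow> (nat \<Rightarrow> real) \<Rightarrow> real. \<forall>i<d. \<forall>j<d.
        continuous_map (Euclidean_space d) euclideanreal (D i j) \<and>
        (\<forall>x\<in>Rn d. ((\<lambda>t. V (x(j := t)) i) has_real_derivative D i j x) (at (x j))))"

definition solves_VI :: "nat \<Rightarrow> ((nat \<Rightarrow> real) \<Rightarrow> nat \<Rightarrow> real) \<Rightarrow> (nat \<Rightarrow> real) \<Rightarrow> bool" where
  "solves_VI d V s \<longleftrightarrow> s \<in> Rn d \<and> (\<forall>x\<in>Rn d. inner_Rn d (\<lambda>i. x i - s i) (V x) \<ge> 0)"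

end

theory Submission
  imports Defs
begin

text \<open>
  With \<open>w\<^sub>n = z\<^sub>n + \<gamma> V(z\<^sub>n\<^sub>-\<^sub>1)\<close> the iteration is the past extragradient method
  \<open>w\<^sub>n\<^sub>+\<^sub>1 = w\<^sub>n - \<gamma> V(z\<^sub>n)\<close>, and monotonicity at \<open>0\<close> gives
  \<open>|w\<^sub>n\<^sub>+\<^sub>1|\<^sup>2 \<le> |w\<^sub>n|\<^sup>2 + \<gamma>\<^sup>2 |V(z\<^sub>n) - V(z\<^sub>n\<^sub>-\<^sub>1)|\<^sup>2 - \<gamma>\<^sup>2 |V(z\<^sub>n\<^sub>-\<^sub>1)|\<^sup>2\<close>.
  Since \<open>\<gamma>L \<le> 1/16\<close>, the Lipschitz bound makes the middle term a small multiple of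
  \<open>\<gamma>\<^sup>2 (|V(z\<^sub>n\<^sub>-\<^sub>1)|\<^sup>2 + |V(z\<^sub>n\<^sub>-\<^sub>2)|\<^sup>2)\<close>, so it is absorbed by the last one. Telescoping bounds
  \<open>\<Sum>\<^sub>n |V(z\<^sub>n)|\<^sup>2\<close> by \<open>8 |z\<^sub>0|\<^sup>2 / \<gamma>\<^sup>2\<close>, which yields both claims.
\<close>

lemma norm2_nonneg [simp]: "norm2 d x \<ge> 0"
  by (simp add: norm2_def)

lemma norm2_power2: "(norm2 d x)\<^sup>2 = (\<Sum>i<d. (x i)\<^sup>2)"
  by (simp add: norm2_def L2_set_def sum_nonneg)

lemma norm2_power2_two_diff_le:
  "(norm2 d (\<lambda>i. 2 * x i - y i))\<^sup>2 \<le> 8 * (norm2 d x)\<^sup>2 + 2 * (norm2 d y)\<^sup>2"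
proof -
  have "(2 * a - b)\<^sup>2 \<le> 8 * a\<^sup>2 + 2 * b\<^sup>2" for a b :: real
    \<comment> \<open>The slack is exactly a square: \<open>(2 * a - b)\<^sup>2 + (2 * a +
      b)\<^sup>2 = 8 * a\<^sup>2 + 2 * b\<^sup>2\<close>.\<close>
    using zero_le_power2[of "2 * a + b"] by (simp add: power2_eq_square algebra_simps)
  then show ?thesis
    unfolding norm2_power2 sum_distrib_left sum.distrib[symmetric] by (intro sum_mono) auto
qed

lemma Min_le_sqrt_average:
  fixes f :: "nat \<Rightarrow> real"
  assumes "\<And>i. f i \<ge> 0" and "n \<ge> 1" and "(\<Sum>i=1..n. (f i)\<^sup>2) \<le> B"
  shows "Min (f ` {1..n}) \<le> sqrt (B / real n)"
proof -
  let ?m = "Min (f ` {1..n})"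
  have m0: "?m \<ge> 0"
    using assms by simp
  have "real n * ?m\<^sup>2 = (\<Sum>i=1..n. ?m\<^sup>2)"
    by simp
  also have "\<dots> \<le> (\<Sum>i=1..n. (f i)\<^sup>2)"
    using m0 by (intro sum_mono power_mono) auto
  finally have "?m\<^sup>2 \<le> B / real n"
    using assms by (simp add: field_simps)
  then show ?thesis
    by (rule real_le_rsqrt)
qed

locale optimistic_gradient =
  fixes d :: nat and V :: "(nat \<Rightarrow> real) \<Rightarrow> nat \<Rightarrow> real" and L \<gamma> :: real and z :: "nat \<Rightarrow> nat \<Rightarrow> real"
  assumes maps: "V \<in> Rn d \<rightarrow> Rn d"
    and mono: "monotone_field d V"
    and L_pos: "L > 0"
    and lip: "lipschitz_map d L V"
    and V_zero: "V (\<lambda>_. 0) = (\<lambda>_. 0)"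
    and \<gamma>_pos: "\<gamma> > 0"
    and \<gamma>_le: "\<gamma> \<le> 1 / (16 * L)"
    and z0_in: "z 0 \<in> Rn d"
    and z1: "z 1 = z 0"
    and z_rec: "\<And>n. z (Suc (Suc n)) = (\<lambda>i. z (Suc n) i - 2 * \<gamma> * V (z (Suc n)) i + \<gamma> * V (z n) i)"
begin

text \<open>Indexed one lower than in the overview, to avoid a predecessor: \<open>w n\<close> is
  its \<open>w\<^sub>n\<^sub>+\<^sub>1\<close>. Hence \<open>w (Suc n)\<close> is \<open>w n\<close>
  minus \<gamma> times \<open>V (z (Suc n))\<close>.\<close>

definition w :: "nat \<Rightarrow> nat \<Rightarrow> real" where
  "w n = (\<lambda>i. z (Suc n) i + \<gamma> * V (z n) i)"

lemma zero_in_Rn: "(\<lambda>_. 0) \<in> Rn d"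
  by (simp add: topspace_Euclidean_space)

lemma z_in: "z n \<in> Rn d"
proof (induction n rule: induct_nat_012)
  case (ge2 n)
  then have "V (z n) \<in> Rn d" "V (z (Suc n)) \<in> Rn d"
    using maps by auto
  with ge2 show ?case
    by (simp add: z_rec topspace_Euclidean_space)
qed (use z0_in z1 in auto)

text \<open>Monotonicity tested against 0, where \<open>V\<close> vanishes. This drives the energy
  decrease in \<open>w_step\<close> and is also the variational inequality at 0.\<close>

lemma inner_V_nonneg:
  assumes "x \<in> Rn d"
  shows "inner_Rn d x (V x) \<ge> 0"
  using mono assms zero_in_Rn V_zero unfolding monotone_field_def by fastforce

lemma norm2_V_le:
  assumes "x \<in> Rn d"
  shows "norm2 d (V x) \<le> L * norm2 d x"
  using lip assms zero_in_Rn V_zero unfolding lipschitz_map_def by fastforce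

lemma \<gamma>L_le: "\<gamma> * L \<le> 1 / 16"
  using \<gamma>_le L_pos by (simp add: field_simps)

lemma w_step:
  "(norm2 d (w (Suc n)))\<^sup>2 \<le> (norm2 d (w n))\<^sup>2
     + \<gamma>\<^sup>2 * (norm2 d (\<lambda>i. V (z (Suc n)) i - V (z n) i))\<^sup>2 - \<gamma>\<^sup>2 * (norm2 d (V (z n)))\<^sup>2"
proof -
  \<comment> \<open>Expand the square of \<open>w n\<close> minus \<gamma> times
    \<open>V (z (Suc n))\<close>, substitute the definition of \<open>w n\<close> in the cross term,
    and complete the square in the two values of \<open>V\<close>.\<close>
  have "(norm2 d (w (Suc n)))\<^sup>2 = (norm2 d (w n))\<^sup>2
     + \<gamma>\<^sup>2 * (norm2 d (\<lambda>i. V (z (Suc n)) i - V (z n) i))\<^sup>2 - \<gamma>\<^sup>2 * (norm2 d (V (z n)))\<^sup>2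
     - 2 * \<gamma> * inner_Rn d (z (Suc n)) (V (z (Suc n)))"
    unfolding norm2_power2 inner_Rn_def sum_distrib_left sum.distrib[symmetric] sum_subtractf[symmetric]
    by (intro sum.cong) (simp_all add: w_def z_rec power2_eq_square algebra_simps)
  then show ?thesis
    using inner_V_nonneg[OF z_in, of "Suc n"] \<gamma>_pos by simp
qed

lemma V_diff_le:
  "(norm2 d (\<lambda>i. V (z (Suc (Suc n))) i - V (z (Suc n)) i))\<^sup>2
     \<le> (norm2 d (V (z (Suc n))))\<^sup>2 / 32 + (norm2 d (V (z n)))\<^sup>2 / 128"
proof -
  let ?u = "\<lambda>i. 2 * V (z (Suc n)) i - V (z n) i"
  have "norm2 d (\<lambda>i. V (z (Suc (Suc n))) i - V (z (Suc n)) i)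
      \<le> L * norm2 d (\<lambda>i. z (Suc (Suc n)) i - z (Suc n) i)"
    using lip z_in unfolding lipschitz_map_def by blast
  then have "(norm2 d (\<lambda>i. V (z (Suc (Suc n))) i - V (z (Suc n)) i))\<^sup>2
      \<le> (L * norm2 d (\<lambda>i. z (Suc (Suc n)) i - z (Suc n) i))\<^sup>2"
    by (intro power_mono) auto
  \<comment> \<open>By the recursion, consecutive iterates differ by \<open>?u\<close> times
    -\<gamma>.\<close>
  also have "\<dots> = (\<gamma> * L)\<^sup>2 * (norm2 d ?u)\<^sup>2"
    unfolding power_mult_distrib norm2_power2 sum_distrib_left
    by (intro sum.cong) (simp_all add: z_rec power2_eq_square algebra_simps)
  also have "\<dots> \<le> (1 / 16)\<^sup>2 * (norm2 d ?u)\<^sup>2"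
    using \<gamma>L_le \<gamma>_pos L_pos by (intro mult_right_mono power_mono) auto
  also have "\<dots> \<le> (1 / 16)\<^sup>2 * (8 * (norm2 d (V (z (Suc n))))\<^sup>2 + 2 * (norm2 d (V (z n)))\<^sup>2)"
    by (intro mult_left_mono norm2_power2_two_diff_le) auto
  finally show ?thesis
    by (simp add: power2_eq_square)
qed

text \<open>The Lipschitz error at one step involves the previous value of \<open>V\<close> with
  weight 1/128; the middle term is a reserve of exactly that size, so the sum telescopes by
  induction.\<close>

lemma potential_le:
  "(norm2 d (w (Suc n)))\<^sup>2 + \<gamma>\<^sup>2 * (norm2 d (V (z n)))\<^sup>2 / 128
     + \<gamma>\<^sup>2 / 2 * (\<Sum>i\<le>n. (norm2 d (V (z i)))\<^sup>2) \<le> (norm2 d (w 0))\<^sup>2"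
proof (induction n)
  case 0
  \<comment> \<open>The start \<open>z 1 = z 0\<close> removes the first error term, which
    \<open>V_diff_le\<close> does not cover.\<close>
  have "norm2 d (\<lambda>i. V (z (Suc 0)) i - V (z 0) i) = 0"
    using z1 by (simp add: norm2_def L2_set_def)
  then have "(norm2 d (w (Suc 0)))\<^sup>2 \<le> (norm2 d (w 0))\<^sup>2 - (\<gamma> * norm2 d (V (z 0)))\<^sup>2"
    using w_step[of 0] by (simp add: power_mult_distrib)
  moreover have "(\<gamma> * norm2 d (V (z 0)))\<^sup>2 \<ge> 0"
    by (rule zero_le_power2)
  ultimately have "(norm2 d (w (Suc 0)))\<^sup>2 + 65 * (\<gamma> * norm2 d (V (z 0)))\<^sup>2 / 128 \<le> (norm2 d (w 0))\<^sup>2"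
    by linarith
  then show ?case
    by (simp add: power_mult_distrib)
next
  case (Suc n)
  let ?v = "\<lambda>n. \<gamma>\<^sup>2 * (norm2 d (V (z n)))\<^sup>2"
  have "\<gamma>\<^sup>2 * (norm2 d (\<lambda>i. V (z (Suc (Suc n))) i - V (z (Suc n)) i))\<^sup>2
      \<le> ?v (Suc n) / 32 + ?v n / 128"
    using mult_left_mono[OF V_diff_le[of n], of "\<gamma>\<^sup>2"] by (simp add: algebra_simps)
  moreover have "?v (Suc n) \<ge> 0"
    by simp
  \<comment> \<open>The old reserve pays for \<open>?v n / 128\<close>. Of the decrease 1 - 1/32 =
    124/128 in \<open>?v (Suc n)\<close>, 65/128 is kept: 1/128 renews the reserve and 64/128 is the
    new summand.\<close>
  ultimately have "(norm2 d (w (Suc (Suc n))))\<^sup>2 + 65 * ?v (Suc n) / 128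
      + \<gamma>\<^sup>2 / 2 * (\<Sum>i\<le>n. (norm2 d (V (z i)))\<^sup>2) \<le> (norm2 d (w 0))\<^sup>2"
    using w_step[of "Suc n"] Suc by linarith
  then show ?case
    by (simp add: distrib_left)
qed

lemma norm2_w0_le: "(norm2 d (w 0))\<^sup>2 \<le> 4 * (norm2 d (z 0))\<^sup>2"
proof -
  have "norm2 d (w 0) \<le> norm2 d (z 0) + norm2 d (\<lambda>i. \<gamma> * V (z 0) i)"
    using z1 unfolding w_def norm2_def by (simp add: L2_set_triangle_ineq)
  also have "norm2 d (\<lambda>i. \<gamma> * V (z 0) i) = \<gamma> * norm2 d (V (z 0))"
    using \<gamma>_pos by (simp add: norm2_def L2_set_right_distrib)
  also have "\<dots> \<le> \<gamma> * L * norm2 d (z 0)"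
    using norm2_V_le[OF z0_in] \<gamma>_pos by simp
  also have "\<dots> \<le> 1 * norm2 d (z 0)"
    using \<gamma>L_le by (intro mult_right_mono) auto
  finally have "(norm2 d (w 0))\<^sup>2 \<le> (2 * norm2 d (z 0))\<^sup>2"
    by (intro power_mono) auto
  then show ?thesis
    by (simp add: power_mult_distrib)
qed

lemma sum_norm2_V_le: "(\<Sum>i\<le>n. (norm2 d (V (z i)))\<^sup>2) \<le> 8 * (norm2 d (z 0))\<^sup>2 / \<gamma>\<^sup>2"
proof -
  have "\<gamma>\<^sup>2 / 2 * (\<Sum>i\<le>n. (norm2 d (V (z i)))\<^sup>2) \<le> 4 * (norm2 d (z 0))\<^sup>2"
    using potential_le[of n] norm2_w0_le
      zero_le_power2[of "norm2 d (w (Suc n))"] zero_le_power2[of "\<gamma> * norm2 d (V (z n))"]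
    unfolding power_mult_distrib by linarith
  then show ?thesis
    using \<gamma>_pos by (simp add: field_simps)
qed

lemma norm2_V_tendsto_0: "(\<lambda>n. norm2 d (V (z n))) \<longlonglongrightarrow> 0"
proof -
  have "summable (\<lambda>n. (norm2 d (V (z n)))\<^sup>2)"
    using sum_norm2_V_le by (intro bounded_imp_summable) auto
  then have "(\<lambda>n. (norm2 d (V (z n)))\<^sup>2) \<longlonglongrightarrow> 0"
    by (rule summable_LIMSEQ_zero)
  then show ?thesis
    by simp
qed

lemma Min_norm2_V_le:
  assumes "n \<ge> 1"
  shows "Min ((\<lambda>i. norm2 d (V (z i))) ` {1..n})
     \<le> 3 * (sqrt (1 / \<gamma>\<^sup>2 + L\<^sup>2) * (norm2 d (z 0) / sqrt (real n)))"
proof -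
  have "(\<Sum>i=1..n. (norm2 d (V (z i)))\<^sup>2) \<le> (\<Sum>i\<le>n. (norm2 d (V (z i)))\<^sup>2)"
    by (intro sum_mono2) auto
  also note sum_norm2_V_le
  finally have "Min ((\<lambda>i. norm2 d (V (z i))) ` {1..n}) \<le> sqrt (8 * (norm2 d (z 0))\<^sup>2 / \<gamma>\<^sup>2 / real n)"
    using assms by (intro Min_le_sqrt_average) auto
  \<comment> \<open>Rounding 8 up to a perfect square lets the constant leave the root as 3; adding
    \<open>L\<^sup>2\<close> only enlarges the bound.\<close>
  also have "\<dots> \<le> sqrt (3\<^sup>2 * ((1 / \<gamma>\<^sup>2 + L\<^sup>2) * ((norm2 d (z 0))\<^sup>2 / real n)))"
  proof (rule real_sqrt_le_mono)
    let ?r = "(norm2 d (z 0))\<^sup>2 / real n"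
    have "8 * (1 / \<gamma>\<^sup>2) * ?r \<le> 3\<^sup>2 * (1 / \<gamma>\<^sup>2 + L\<^sup>2) * ?r"
      by (intro mult_right_mono mult_mono) auto
    then show "8 * (norm2 d (z 0))\<^sup>2 / \<gamma>\<^sup>2 / real n \<le> 3\<^sup>2 * ((1 / \<gamma>\<^sup>2 + L\<^sup>2) * ?r)"
      unfolding mult.assoc by simp
  qed
  also have "\<dots> = 3 * (sqrt (1 / \<gamma>\<^sup>2 + L\<^sup>2) * (norm2 d (z 0) / sqrt (real n)))"
    by (simp only: real_sqrt_mult real_sqrt_divide real_sqrt_abs) simp
  finally show ?thesis .
qed

end

theorem theorem6p4:
  shows "\<exists>C::real. C > 0 \<and>
    (\<forall>(d::nat) (V :: (nat \<Rightarrow> real) \<Rightarrow> nat \<Rightarrow> real) (L::real) (\<gamma>::real) (z :: nat \<Rightarrow> nat \<Rightarrow> real).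
       V \<in> Rn d \<rightarrow> Rn d \<longrightarrow>
       monotone_field d V \<longrightarrow>
       C1_map d V \<longrightarrow>
       L > 0 \<longrightarrow> lipschitz_map d L V \<longrightarrow>
       V (\<lambda>_. 0) = (\<lambda>_. 0) \<longrightarrow>
       0 < \<gamma> \<longrightarrow> \<gamma> \<le> 1 / (16 * L) \<longrightarrow>
       z 0 \<in> Rn d \<longrightarrow> z 1 = z 0 \<longrightarrow>
       (\<forall>n\<ge>1. z (n + 1) = (\<lambda>i. z n i - 2 * \<gamma> * V (z n) i + \<gamma> * V (z (n - 1)) i)) \<longrightarrow>
         solves_VI d V (\<lambda>_. 0) \<and>
         (\<forall>n\<ge>1. Min ((\<lambda>i. norm2 d (V (z i))) ` {1..n})
                  \<le> C * (sqrt (1 / \<gamma>\<^sup>2 + L\<^sup>2) * (norm2 d (z 0) / sqrt (real n)))) \<and>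
         (\<lambda>n. norm2 d (V (z n))) \<longlonglongrightarrow> 0)"
proof (intro exI[of _ 3] conjI allI impI)
  fix d :: nat and V :: "(nat \<Rightarrow> real) \<Rightarrow> nat \<Rightarrow> real" and L \<gamma> :: real and z :: "nat \<Rightarrow> nat \<Rightarrow> real"
  assume "V \<in> Rn d \<rightarrow> Rn d" "monotone_field d V" "L > 0" "lipschitz_map d L V"
    "V (\<lambda>_. 0) = (\<lambda>_. 0)" "0 < \<gamma>" "\<gamma> \<le> 1 / (16 * L)" "z 0 \<in> Rn d" "z 1 = z 0"
    and rec: "\<forall>n\<ge>1. z (n + 1) = (\<lambda>i. z n i - 2 * \<gamma> * V (z n) i + \<gamma> * V (z (n - 1)) i)"
  then interpret optimistic_gradient d V L \<gamma> z
    \<comment> \<open>Instantiating at a successor turns \<open>n - 1\<close> into a plain index,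
      the form of \<open>z_rec\<close>.\<close>
    by unfold_locales (use rec[rule_format, of "Suc _"] in auto)
  show "solves_VI d V (\<lambda>_. 0)"
    using zero_in_Rn inner_V_nonneg by (simp add: solves_VI_def)
  show "(\<lambda>n. norm2 d (V (z n))) \<longlonglongrightarrow> 0"
    by (rule norm2_V_tendsto_0)
  show "Min ((\<lambda>i. norm2 d (V (z i))) ` {1..n})
      \<le> 3 * (sqrt (1 / \<gamma>\<^sup>2 + L\<^sup>2) * (norm2 d (z 0) / sqrt (real n)))" if "n \<ge> 1" for n
    using that by (rule Min_norm2_V_le)
qed simp

end
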